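(* Let $n\ge 2$, let $G$ be the complete graph on the vertices $\{x_1,\ldots,x_n\}$ and let $I=I(G)$ be its edge ideal. Then: (1) For any $s\in\mathbb{N}$, $\alpha(I^{(s)})=s+\left\lceil\frac{s}{n-1}\right\rceil$. In particular, the Waldschmidt constant of $I$ is $\widehat{\alpha}(I)=\frac{n}{n-1}$. (2) For positive integers $s,t$: $\alpha(I^{(s)})<\alpha(I^t)$ if and only if $I^{(s)}\nsubseteq I^t$. (3) The resurgence of $I$ is $\rho(I)=\frac{2n-2}{n}$.
   Context: Let $k$ be a field and let $R=k[x_1,\ldots,x_n]$. The edge ideal $I(G)\subseteq R$ is generated by the products $x_ix_j$ with $\{x_i,x_j\}$ an edge of $G$. The $s$-th symbolic power of an ideal $I$ is $I^{(s)}=\bigcap_{p\in\operatorname{Ass} I}(I^sR_p\cap R)$; for an edge ideal it equals $\bigcap_V P_V^s$, where $V$ runs over the minimal vertex covers of $G$ and $P_V$ is the ideal generated by the variables in $V$. For a nonzero homogeneous ideal $J$, $\alpha(J)$ is the least degree of a generator (equivalently, of a nonzero element) of $J$. The Waldschmidt constant is $\widehat{\alpha}(I)=\lim_{s\to\infty}\alpha(I^{(s)})/s$, and the resurgence is $\rho(I)=\sup\{\,s/t \mid s,t\ge 1,\ I^{(s)}\nsubseteq I^t\,\}$. *)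

theory Defs
  imports
    Complex_Main
    "HOL-Library.Poly_Mapping"
    "HOL-Library.Cardinality"
    "HOL-Library.Extended_Real"
    "HOL-Computational_Algebra.Fraction_Field"
begin

text \<open>Ideals are the submodules of the ring regarded as a module over itself.\<close>

lemma module_times: "module ((*) :: 'a::comm_ring_1 \<Rightarrow> 'a \<Rightarrow> 'a)"
  by unfold_locales (simp_all add: algebra_simps)

definition is_ideal :: "'a::comm_ring_1 set \<Rightarrow> bool" where
  "is_ideal J \<longleftrightarrow> module.subspace (*) J"

definition ideal_gen :: "'a::comm_ring_1 set \<Rightarrow> 'a set" where
  "ideal_gen S = module.span (*) S"

definition ideal_prod :: "'a::comm_ring_1 set \<Rightarrow> 'a set \<Rightarrow> 'a set" where
  "ideal_prod I J = ideal_gen {a * b | a b. a \<in> I \<and> b \<in> J}"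

primrec ideal_power :: "'a::comm_ring_1 set \<Rightarrow> nat \<Rightarrow> 'a set" where
  "ideal_power I 0 = UNIV"
| "ideal_power I (Suc s) = ideal_prod I (ideal_power I s)"

definition prime_ideal :: "'a::comm_ring_1 set \<Rightarrow> bool" where
  "prime_ideal p \<longleftrightarrow>
     is_ideal p \<and> p \<noteq> UNIV \<and> (\<forall>a b. a * b \<in> p \<longrightarrow> a \<in> p \<or> b \<in> p)"

text \<open>
  The associated primes of \<open>R/I\<close>: the prime ideals that are annihilators of the
  class of some \<open>f\<close> in \<open>R/I\<close>.
\<close>

definition Ass :: "'a::comm_ring_1 set \<Rightarrow> 'a set set" where
  "Ass I = {p. prime_ideal p \<and> (\<exists>f. p = {r. r * f \<in> I})}"

text \<open>
  For a domain \<open>R\<close>, the localization \<open>R\<^sub>p\<close> is taken inside the fraction field of \<open>R\<close>;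
  the map \<open>a \<mapsto> Fract a 1\<close> is the embedding of \<open>R\<close>.  As \<open>0 \<in> p\<close>,
  all denominators below are nonzero.
\<close>

definition localization :: "'a::idom set \<Rightarrow> 'a fract set" where
  "localization p = {Fract a u | a u. u \<notin> p}"

text \<open>The extension \<open>J R\<^sub>p\<close>: the ideal of \<open>R\<^sub>p\<close> generated by \<open>J\<close>.\<close>

definition extension :: "'a::idom set \<Rightarrow> 'a set \<Rightarrow> 'a fract set" where
  "extension p J =
     {(\<Sum>i<m. c i * Fract (a i) 1) | (m::nat) c a. \<forall>i<m. c i \<in> localization p \<and> a i \<in> J}"

definition symbolic_power :: "'a::idom set \<Rightarrow> nat \<Rightarrow> 'a set" where
  "symbolic_power I s = (\<Inter>p\<in>Ass I. {f. Fract f 1 \<in> extension p (ideal_power I s)})"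

definition resurgence :: "'a::idom set \<Rightarrow> ereal" where
  "resurgence I = Sup {ereal (real s / real t) | s t.
     s \<ge> 1 \<and> t \<ge> 1 \<and> \<not> symbolic_power I s \<subseteq> ideal_power I t}"

text \<open>
  The polynomial ring over \<open>'k\<close> in the variables indexed by \<open>'v\<close>: finitely supported
  functions from exponent vectors to coefficients.
\<close>

type_synonym ('v, 'k) mpoly = "('v \<Rightarrow>\<^sub>0 nat) \<Rightarrow>\<^sub>0 'k"

definition var :: "'v \<Rightarrow> ('v, 'k::comm_ring_1) mpoly" where
  "var v = Poly_Mapping.single (Poly_Mapping.single v 1) 1"

definition monom_degree :: "('v \<Rightarrow>\<^sub>0 nat) \<Rightarrow> nat" where
  "monom_degree m = (\<Sum>v\<in>Poly_Mapping.keys m. Poly_Mapping.lookup m v)"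

text \<open>The zero polynomial gets total degree \<open>0\<close>.\<close>

definition total_degree :: "('v, 'k::comm_ring_1) mpoly \<Rightarrow> nat" where
  "total_degree f = Max (insert 0 (monom_degree ` Poly_Mapping.keys f))"

text \<open>Meaningful for nonzero homogeneous ideals.\<close>

definition initial_degree :: "('v, 'k::comm_ring_1) mpoly set \<Rightarrow> nat" where
  "initial_degree J = (LEAST d. \<exists>f\<in>J. f \<noteq> 0 \<and> total_degree f = d)"

definition waldschmidt_seq :: "('v::linorder, 'k::idom) mpoly set \<Rightarrow> nat \<Rightarrow> real" where
  "waldschmidt_seq I s = real (initial_degree (symbolic_power I s)) / real s"

definition waldschmidt_constant :: "('v::linorder, 'k::idom) mpoly set \<Rightarrow> real" where
  "waldschmidt_constant I = lim (waldschmidt_seq I)"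

text \<open>A simple graph on the vertex set \<open>UNIV :: 'v set\<close> is given by its set of two-element edges.\<close>

definition edge_ideal :: "'v set set \<Rightarrow> ('v, 'k::comm_ring_1) mpoly set" where
  "edge_ideal E = ideal_gen {var u * var v | u v. {u, v} \<in> E}"

definition complete_graph :: "'v set set" where
  "complete_graph = {{u, v} | u v. u \<noteq> v}"

end

theory Submission
  imports Defs
begin

text \<open>
  Both kinds of powers are determined by conditions on single monomials \<open>m\<close>. Let \<open>d\<^sub>i m\<close> be the
  degree of \<open>m\<close> in the variables other than \<open>i\<close>. Then \<open>m\<close> lies in the \<open>s\<close>-th symbolic power iff
  \<open>s \<le> d\<^sub>i m\<close> for all \<open>i\<close>, and it lies in the \<open>s\<close>-th ordinary power iff moreover its total degree is
  at least \<open>2 * s\<close>. So containment is decided by initial degrees. Summing \<open>s \<le> d\<^sub>i m\<close> over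
  all \<open>i\<close> bounds the degree of \<open>m\<close> from below, and a monomial with evenly distributed exponents
  attains the bound.
\<close>

section \<open>Monomial conditions\<close>

text \<open>Encoded as a condition on the monomials that occur, so that intersections of ideals
  become conjunctions. It is an ideal once \<open>P\<close> is stable under multiplication by
  monomials.\<close>

definition monomial_ideal :: "(('v \<Rightarrow>\<^sub>0 nat) \<Rightarrow> bool) \<Rightarrow> ('v, 'k::comm_ring_1) mpoly set" where
  "monomial_ideal P = {f. \<forall>m\<in>Poly_Mapping.keys f. P m}"

lemma is_ideal_iff:
  "is_ideal J \<longleftrightarrow> 0 \<in> J \<and> (\<forall>x\<in>J. \<forall>y\<in>J. x + y \<in> J) \<and> (\<forall>c. \<forall>x\<in>J. c * x \<in> J)"
  unfolding is_ideal_def module.subspace_def[OF module_times] by blast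

lemma is_ideal_mult: "is_ideal J \<Longrightarrow> x \<in> J \<Longrightarrow> c * x \<in> J"
  by (simp add: is_ideal_iff)

lemma is_ideal_ideal_gen: "is_ideal (ideal_gen S)"
  unfolding is_ideal_def ideal_gen_def by (rule module.subspace_span[OF module_times])

lemma ideal_gen_base: "a \<in> S \<Longrightarrow> a \<in> ideal_gen S"
  unfolding ideal_gen_def by (rule module.span_base[OF module_times])

lemma ideal_gen_minimal: "S \<subseteq> J \<Longrightarrow> is_ideal J \<Longrightarrow> ideal_gen S \<subseteq> J"
  unfolding ideal_gen_def is_ideal_def by (rule module.span_minimal[OF module_times])

lemma is_ideal_sum: "is_ideal J \<Longrightarrow> (\<And>x. x \<in> B \<Longrightarrow> f x \<in> J) \<Longrightarrow> sum f B \<in> J"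
  unfolding is_ideal_def by (rule module.subspace_sum[OF module_times])

lemma is_ideal_ideal_power: "is_ideal (ideal_power J s)"
  by (cases s) (auto simp: ideal_prod_def is_ideal_ideal_gen, simp add: is_ideal_iff)

lemma is_ideal_monomial_ideal:
  assumes "\<And>a b. P b \<Longrightarrow> P (a + b)"
  shows "is_ideal (monomial_ideal P)"
  unfolding is_ideal_iff monomial_ideal_def
proof (intro conjI ballI allI CollectI)
  fix x y :: "('a, 'b) mpoly" and m
  assume "x \<in> {f. \<forall>m\<in>Poly_Mapping.keys f. P m}" "y \<in> {f. \<forall>m\<in>Poly_Mapping.keys f. P m}"
    "m \<in> Poly_Mapping.keys (x + y)"
  then show "P m"
    using keys_add[of x y] by blast
next
  fix c x :: "('a, 'b) mpoly" and m
  assume "x \<in> {f. \<forall>m\<in>Poly_Mapping.keys f. P m}" "m \<in> Poly_Mapping.keys (c * x)"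
  then show "P m"
    using keys_mult[of c x] assms by blast
qed simp

lemma mpoly_eq_sum_monomials:
  fixes f :: "('v, 'k::comm_ring_1) mpoly"
  shows "f = (\<Sum>m\<in>Poly_Mapping.keys f. Poly_Mapping.single m (Poly_Mapping.lookup f m))"
proof (rule poly_mapping_eqI)
  fix k
  have "Poly_Mapping.lookup f k =
      (\<Sum>m\<in>Poly_Mapping.keys f. if m = k then Poly_Mapping.lookup f m else 0)"
    by (simp add: in_keys_iff)
  then show "Poly_Mapping.lookup f k = Poly_Mapping.lookup
      (\<Sum>m\<in>Poly_Mapping.keys f. Poly_Mapping.single m (Poly_Mapping.lookup f m)) k"
    by (simp add: lookup_sum lookup_single when_def)
qed

text \<open>A polynomial is the sum of its terms and an ideal is closed under sums, so only single
  terms need testing.\<close>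

lemma monomial_ideal_subset:
  fixes J :: "('v, 'k::comm_ring_1) mpoly set"
  assumes "is_ideal J" "\<And>m c. P m \<Longrightarrow> Poly_Mapping.single m c \<in> J"
  shows "monomial_ideal P \<subseteq> J"
proof
  fix f :: "('v, 'k) mpoly"
  assume "f \<in> monomial_ideal P"
  then show "f \<in> J"
    by (subst mpoly_eq_sum_monomials) (auto simp: monomial_ideal_def intro!: is_ideal_sum assms)
qed

text \<open>The monomial \<open>m\<close> itself attains \<open>d\<close>. Conversely, every nonzero
  element has a monomial, whose degree is at most the total degree.\<close>

lemma initial_degree_monomial_ideal:
  assumes "P m" and "monom_degree m = d" and "\<And>m. P m \<Longrightarrow> d \<le> monom_degree m"
  shows "initial_degree (monomial_ideal P :: ('v, 'k::comm_ring_1) mpoly set) = d"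
  unfolding initial_degree_def
proof (rule Least_equality)
  let ?f = "Poly_Mapping.single m 1 :: ('v, 'k) mpoly"
  have "?f \<in> monomial_ideal P" "?f \<noteq> 0" "total_degree ?f = d"
    using assms by (auto simp: monomial_ideal_def total_degree_def simp flip: keys_eq_empty)
  then show "\<exists>f\<in>monomial_ideal P. (f :: ('v, 'k) mpoly) \<noteq> 0 \<and> total_degree f = d"
    by blast
next
  fix e
  assume "\<exists>f\<in>monomial_ideal P. (f :: ('v, 'k) mpoly) \<noteq> 0 \<and> total_degree f = e"
  then obtain f :: "('v, 'k) mpoly" where f: "f \<in> monomial_ideal P" "f \<noteq> 0" "total_degree f = e"
    by blast
  then obtain k where k: "k \<in> Poly_Mapping.keys f"
    by (metis all_not_in_conv keys_eq_empty)
  then have "d \<le> monom_degree k"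
    using f(1) assms(3) by (auto simp: monomial_ideal_def)
  also have "\<dots> \<le> total_degree f"
    unfolding total_degree_def using k by (intro Max_ge) auto
  finally show "d \<le> e"
    using f(3) by simp
qed

text \<open>
  The initial forms of \<open>f\<close> and \<open>g\<close> for the grading \<open>w\<close> have a nonzero product, whose weight is
  the sum of theirs.
\<close>

lemma min_weight_mult:
  fixes f g :: "('v::linorder, 'k::idom) mpoly" and w :: "('v \<Rightarrow>\<^sub>0 nat) \<Rightarrow> nat"
  assumes w: "\<And>a b. w (a + b) = w a + w b"
    and f: "\<exists>m\<in>Poly_Mapping.keys f. w m < s" and g: "\<exists>m\<in>Poly_Mapping.keys g. w m < Suc t"
  shows "\<exists>m\<in>Poly_Mapping.keys (f * g). w m < s + t"
proof -
  \<comment> \<open>The homogeneous component of \<open>h\<close> of weight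
    \<open>d\<close>.\<close>
  define part where "part h d = Poly_Mapping.mapp (\<lambda>m c. c when w m = d) h"
    for h :: "('v, 'k) mpoly" and d
  have lookup_part: "Poly_Mapping.lookup (part h d) m = (Poly_Mapping.lookup h m when w m = d)" for h d m
    by (auto simp: part_def lookup_mapp when_def in_keys_iff)
  have keys_part: "w m = d" if "m \<in> Poly_Mapping.keys (part h d)" for h d m
    using that by (auto simp: in_keys_iff lookup_part when_def split: if_splits)
  have least: "\<exists>d<r. part h d \<noteq> 0 \<and> (\<forall>m\<in>Poly_Mapping.keys (h - part h d). d < w m)"
    if ex: "\<exists>m\<in>Poly_Mapping.keys h. w m < r" for h :: "('v, 'k) mpoly" and r
  proof -
    define d where "d = (LEAST d. \<exists>m\<in>Poly_Mapping.keys h. w m = d)"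
    obtain m0 where m0: "m0 \<in> Poly_Mapping.keys h" "w m0 < r"
      using ex by blast
    have "\<exists>m\<in>Poly_Mapping.keys h. w m = d"
      unfolding d_def by (rule LeastI[of _ "w m0"]) (use m0 in blast)
    then obtain m1 where m1: "m1 \<in> Poly_Mapping.keys h" "w m1 = d"
      by blast
    have min: "d \<le> w m" if "m \<in> Poly_Mapping.keys h" for m
      unfolding d_def by (rule Least_le) (use that in blast)
    have "Poly_Mapping.lookup (part h d) m1 \<noteq> 0"
      using m1 by (simp add: lookup_part in_keys_iff)
    then have "part h d \<noteq> 0"
      by auto
    moreover have "d < w m" if "m \<in> Poly_Mapping.keys (h - part h d)" for m
    proof -
      have "m \<in> Poly_Mapping.keys h" "w m \<noteq> d"
        using that by (auto simp: in_keys_iff lookup_minus lookup_part when_def split: if_splits)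
      then show ?thesis
        using min[of m] by simp
    qed
    moreover have "d < r"
      using min[OF m0(1)] m0(2) by simp
    ultimately show ?thesis
      by blast
  qed
  obtain a where a: "a < s" "part f a \<noteq> 0" "\<forall>m\<in>Poly_Mapping.keys (f - part f a). a < w m"
    using least[OF f] by blast
  \<comment> \<open>\<open>b < Suc t\<close> means \<open>b \<le> t\<close>, hence
    \<open>a + b < s + t\<close>. For \<open>t = 0\<close> the hypothesis on \<open>g\<close> asks
    for a monomial of weight 0.\<close>
  obtain b where b: "b < Suc t" "part g b \<noteq> 0" "\<forall>m\<in>Poly_Mapping.keys (g - part g b). b < w m"
    using least[OF g] by blast
  define h1 where "h1 = part f a * (g - part g b)"
  define h2 where "h2 = (f - part f a) * g"
  \<comment> \<open>The polynomial ring is a domain; this instance rests on the linear order of the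
    variables.\<close>
  have "part f a * part g b \<noteq> 0"
    using a b by simp
  then obtain m where m: "m \<in> Poly_Mapping.keys (part f a * part g b)"
    by (metis all_not_in_conv keys_eq_empty)
  then have wm: "w m = a + b"
    using keys_mult[of "part f a" "part g b"] keys_part w by fastforce
  have gb: "b \<le> w k" if "k \<in> Poly_Mapping.keys g" for k
  proof (cases "w k = b")
    case False
    then have "k \<in> Poly_Mapping.keys (g - part g b)"
      using that by (simp add: in_keys_iff lookup_minus lookup_part)
    then show ?thesis
      using b by force
  qed simp
  \<comment> \<open>All monomials of \<open>h1\<close> and \<open>h2\<close> have weight above
    \<open>a + b\<close>, so they cannot cancel \<open>m\<close>.\<close>
  have "m \<notin> Poly_Mapping.keys h1"
  proof
    assume "m \<in> Poly_Mapping.keys h1"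
    then obtain x y where "m = x + y" "x \<in> Poly_Mapping.keys (part f a)"
      "y \<in> Poly_Mapping.keys (g - part g b)"
      using keys_mult[of "part f a" "g - part g b"] unfolding h1_def by blast
    then show False
      using keys_part[of x f a] b(3) wm w[of x y] by force
  qed
  moreover have "m \<notin> Poly_Mapping.keys h2"
  proof
    assume "m \<in> Poly_Mapping.keys h2"
    then obtain x y where "m = x + y" "x \<in> Poly_Mapping.keys (f - part f a)"
      "y \<in> Poly_Mapping.keys g"
      using keys_mult[of "f - part f a" g] unfolding h2_def by blast
    then show False
      using gb[of y] a(3) wm w[of x y] by force
  qed
  moreover have "f * g = part f a * part g b + h1 + h2"
    by (simp add: h1_def h2_def algebra_simps)
  ultimately have "m \<in> Poly_Mapping.keys (f * g)"
    using m by (simp add: in_keys_iff lookup_add)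
  then show ?thesis
    using wm a b by force
qed

section \<open>Localization at a prime\<close>

text \<open>Denominators can be cleared: a sum of fractions with numerators in \<open>J\<close> is a
  single such fraction, since the complement of a prime is closed under products.\<close>

lemma Fract_mem_extension_iff:
  assumes p: "prime_ideal p" and J: "is_ideal J"
  shows "Fract f 1 \<in> extension p J \<longleftrightarrow> (\<exists>u. u \<notin> p \<and> u * f \<in> J)"
proof
  have p0: "0 \<in> p" and p1: "1 \<notin> p"
    using p by (auto simp: prime_ideal_def is_ideal_iff) (metis mult.right_neutral)
  assume "Fract f 1 \<in> extension p J"
  then obtain m :: nat and c a where eq: "Fract f 1 = (\<Sum>i<m. c i * Fract (a i) 1)"
    and ca: "\<forall>i<m. c i \<in> localization p \<and> a i \<in> J"
    by (auto simp: extension_def)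
  have "\<exists>b u. b \<in> J \<and> u \<notin> p \<and> (\<Sum>i<k. c i * Fract (a i) 1) = Fract b u" if "k \<le> m" for k
    using that
  proof (induction k)
    case 0
    have "0 = Fract 0 (1 :: 'a)"
      by (simp add: Zero_fract_def)
    then show ?case
      using J p1 by (auto simp: is_ideal_iff)
  next
    case (Suc k)
    then obtain b u where bu: "b \<in> J" "u \<notin> p" "(\<Sum>i<k. c i * Fract (a i) 1) = Fract b u"
      by auto
    obtain a' u' where au: "c k = Fract a' u'" "u' \<notin> p"
      using ca[rule_format, of k] Suc.prems unfolding localization_def by auto
    have ak: "a k \<in> J"
      using ca Suc.prems by auto
    have nz: "u \<noteq> 0" "u' \<noteq> 0"
      using bu au p0 by auto
    have "(\<Sum>i<Suc k. c i * Fract (a i) 1) = Fract (b * u' + a' * a k * u) (u * u')"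
      using nz by (simp add: bu au)
    moreover have "b * u' + a' * a k * u \<in> J"
      using J bu ak unfolding is_ideal_iff by (metis mult.commute mult.assoc)
    moreover have "u * u' \<notin> p"
      using p bu au by (auto simp: prime_ideal_def)
    ultimately show ?case
      by blast
  qed
  from this[OF order_refl] obtain b u where bu: "b \<in> J" "u \<notin> p" "Fract f 1 = Fract b u"
    unfolding eq by blast
  then have "u * f = b"
    using p0 eq_fract(1)[of 1 u f b] by (auto simp: mult.commute)
  then show "\<exists>u. u \<notin> p \<and> u * f \<in> J"
    using bu by auto
next
  assume "\<exists>u. u \<notin> p \<and> u * f \<in> J"
  then obtain u where u: "u \<notin> p" "u * f \<in> J"
    by blast
  then have "u \<noteq> 0"
    using p by (auto simp: prime_ideal_def is_ideal_iff)
  \<comment> \<open>Writing \<open>f\<close> as \<open>1/u\<close> times \<open>u * f\<close> gives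
    a sum with one summand.\<close>
  then have "Fract f 1 = (\<Sum>i<(1::nat). Fract 1 u * Fract (u * f) 1)"
    by (simp add: eq_fract)
  moreover have "Fract 1 u \<in> localization p"
    using u by (auto simp: localization_def)
  ultimately show "Fract f 1 \<in> extension p J"
    unfolding extension_def mem_Collect_eq using u(2)
    by (intro exI[of _ 1] exI[of _ "\<lambda>_. Fract 1 u"] exI[of _ "\<lambda>_. u * f"]) simp
qed

section \<open>The edge ideal of the complete graph\<close>

text \<open>The grading that gives weight 0 to the variable \<open>i\<close> and weight 1 to the
  variables of the vertex cover \<open>UNIV - {i}\<close>.\<close>

definition degree_outside :: "'v::finite \<Rightarrow> ('v \<Rightarrow>\<^sub>0 nat) \<Rightarrow> nat" where
  "degree_outside i m = (\<Sum>v\<in>UNIV - {i}. Poly_Mapping.lookup m v)"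

lemma monom_degree_eq_sum:
  fixes m :: "'v::finite \<Rightarrow>\<^sub>0 nat"
  shows "monom_degree m = (\<Sum>v\<in>UNIV. Poly_Mapping.lookup m v)"
  unfolding monom_degree_def by (rule sum.mono_neutral_left) (auto simp: in_keys_iff)

lemma monom_degree_eq: "monom_degree m = degree_outside i m + Poly_Mapping.lookup m i"
  by (simp add: monom_degree_eq_sum degree_outside_def sum.remove[of UNIV i])

lemma monom_degree_add:
  fixes a b :: "'v::finite \<Rightarrow>\<^sub>0 nat"
  shows "monom_degree (a + b) = monom_degree a + monom_degree b"
  by (simp add: monom_degree_eq_sum lookup_add sum.distrib)

lemma degree_outside_add: "degree_outside i (a + b) = degree_outside i a + degree_outside i b"
  by (simp add: degree_outside_def lookup_add sum.distrib)

lemma monom_degree_single: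
  fixes v :: "'v::finite"
  shows "monom_degree (Poly_Mapping.single v k) = k"
  by (simp add: monom_degree_eq_sum lookup_single when_def)

lemma degree_outside_single: "degree_outside i (Poly_Mapping.single v k) = (if v = i then 0 else k)"
  using monom_degree_eq[of "Poly_Mapping.single v k" i]
  by (auto simp: monom_degree_single lookup_single when_def)

lemma degree_outside_zero [simp]: "degree_outside i 0 = 0"
  by (simp add: degree_outside_def)

section \<open>Ordinary powers of the edge ideal\<close>

text \<open>Necessary for divisibility by a product of \<open>s\<close> edges: each edge has degree
  2, and at most one of its ends is \<open>i\<close>. Iterating
  \<open>edge_power_monomial_Suc\<close> shows sufficiency.\<close>

definition edge_power_monomial :: "nat \<Rightarrow> ('v::finite \<Rightarrow>\<^sub>0 nat) \<Rightarrow> bool" where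
  "edge_power_monomial s m \<longleftrightarrow> 2 * s \<le> monom_degree m \<and> (\<forall>i. s \<le> degree_outside i m)"

lemma edge_power_monomial_add:
  "edge_power_monomial s a \<Longrightarrow> edge_power_monomial t b \<Longrightarrow> edge_power_monomial (s + t) (a + b)"
  by (auto simp: edge_power_monomial_def monom_degree_add degree_outside_add intro!: add_mono)

lemma edge_power_monomial_mult:
  "edge_power_monomial s b \<Longrightarrow> edge_power_monomial s (a + b)"
  using edge_power_monomial_add[of 0 a s b] by (simp add: edge_power_monomial_def)

lemma edge_power_monomial_edge:
  "u \<noteq> v \<Longrightarrow> edge_power_monomial s (Poly_Mapping.single u s + Poly_Mapping.single v s)"
  by (auto simp: edge_power_monomial_def monom_degree_add degree_outside_add
      monom_degree_single degree_outside_single)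

lemma pair_mem_complete_graph: "{u, v} \<in> complete_graph \<longleftrightarrow> u \<noteq> v"
  by (auto simp: complete_graph_def doubleton_eq_iff)

lemma edge_ideal_subset:
  "(edge_ideal complete_graph :: ('v::finite, 'k::comm_ring_1) mpoly set)
    \<subseteq> monomial_ideal (edge_power_monomial 1)"
  unfolding edge_ideal_def
proof (rule ideal_gen_minimal)
  show "is_ideal (monomial_ideal (edge_power_monomial 1) :: ('v, 'k) mpoly set)"
    by (rule is_ideal_monomial_ideal) (rule edge_power_monomial_mult)
  show "{var u * var v |u v. {u, v} \<in> complete_graph}
      \<subseteq> (monomial_ideal (edge_power_monomial 1) :: ('v, 'k) mpoly set)"
    using edge_power_monomial_edge[where s = 1]
    by (auto simp: pair_mem_complete_graph monomial_ideal_def var_def mult_single)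
qed

text \<open>
  Dividing by the product of the two variables of largest exponent keeps the remaining
  exponents balanced.
\<close>

lemma edge_power_monomial_Suc:
  assumes "edge_power_monomial (Suc s) m"
  obtains i j m' where "i \<noteq> j" "edge_power_monomial s m'"
    "m = Poly_Mapping.single i 1 + Poly_Mapping.single j 1 + m'"
proof -
  let ?e = "Poly_Mapping.lookup m"
  have out: "Suc s \<le> degree_outside k m" for k
    using assms by (simp add: edge_power_monomial_def)
  have deg: "2 * s + 2 \<le> monom_degree m"
    using assms by (simp add: edge_power_monomial_def)
  have "Max (range ?e) \<in> range ?e"
    by (intro Max_in) auto
  then obtain i where "?e i = Max (range ?e)"
    by (metis rangeE)
  then have i: "?e k \<le> ?e i" for k
    by simp
  \<comment> \<open>With a single variable, \<open>degree_outside i m\<close> would be an empty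
    sum.\<close>
  have "UNIV - {i} \<noteq> {}"
  proof
    assume "UNIV - {i} = {}"
    then show False
      using out[of i] unfolding degree_outside_def by (simp only: sum.empty)
  qed
  then have "Max (?e ` (UNIV - {i})) \<in> ?e ` (UNIV - {i})"
    by (intro Max_in) auto
  then obtain j where j: "j \<noteq> i" "?e j = Max (?e ` (UNIV - {i}))"
    by (metis imageE DiffD2 singletonI)
  have jmax: "?e k \<le> ?e j" if "k \<noteq> i" for k
    unfolding j(2) using that by (intro Max_ge) auto
  \<comment> \<open>Otherwise at most the variable \<open>i\<close> would occur in \<open>m\<close>,
    and \<open>degree_outside i m\<close> would vanish.\<close>
  have "?e j > 0"
  proof (rule ccontr)
    assume "\<not> ?e j > 0"
    then have "?e k = 0" if "k \<noteq> i" for k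
      using jmax[OF that] by simp
    then show False
      using out[of i] by (simp add: degree_outside_def)
  qed
  then have pos: "?e i > 0" "?e j > 0"
    using i[of j] by auto
  define m' where "m' = m - (Poly_Mapping.single i 1 + Poly_Mapping.single j 1)"
  have m: "m = Poly_Mapping.single i 1 + Poly_Mapping.single j 1 + m'"
    using pos j(1)
    by (intro poly_mapping_eqI) (auto simp: m'_def lookup_add lookup_minus lookup_single when_def)
  have "edge_power_monomial s m'"
    unfolding edge_power_monomial_def
  proof (intro conjI allI)
    show "2 * s \<le> monom_degree m'"
      using deg by (subst (asm) m) (simp add: monom_degree_add monom_degree_single)
    fix k
    have *: "degree_outside k m = (if i = k then 0 else 1) + (if j = k then 0 else 1) + degree_outside k m'"
      by (subst m) (simp add: degree_outside_add degree_outside_single)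
    show "s \<le> degree_outside k m'"
    \<comment> \<open>If \<open>k\<close> is an end of the removed edge, only the other end counts
      and \<open>degree_outside k\<close> drops by just 1.\<close>
    proof (cases "k = i \<or> k = j")
      case True
      then show ?thesis
        using * out[of k] j(1) by auto
    next
      case False
      \<comment> \<open>Here it drops by 2. If \<open>degree_outside k m\<close> were only
        \<open>s + 1\<close>, the exponent of \<open>k\<close> would be at least
        \<open>s + 1\<close>, hence also those of \<open>i\<close> and \<open>j\<close>, and their
        sum would already exceed \<open>s + 1\<close>.\<close>
      have "?e i + ?e j = (\<Sum>v\<in>{i, j}. ?e v)"
        using j(1) by simp
      also have "\<dots> \<le> degree_outside k m"
        unfolding degree_outside_def using False by (intro sum_mono2) auto
      finally show ?thesis
        using * out[of k] deg i[of k] jmax[of k] False monom_degree_eq[of m k] by auto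
    qed
  qed
  with m j(1) show ?thesis
    using that by metis
qed

text \<open>Induction on \<open>s\<close>: the conditions add up under products, and conversely
  \<open>edge_power_monomial_Suc\<close> splits off one edge.\<close>

lemma ideal_power_edge_ideal:
  "ideal_power (edge_ideal complete_graph :: ('v::finite, 'k::comm_ring_1) mpoly set) s
    = monomial_ideal (edge_power_monomial s)" (is "ideal_power ?I s = _")
proof (induction s)
  case 0
  show ?case
    by (auto simp: monomial_ideal_def edge_power_monomial_def)
next
  case (Suc s)
  show ?case
  proof
    show "ideal_power ?I (Suc s) \<subseteq> monomial_ideal (edge_power_monomial (Suc s))"
      unfolding ideal_power.simps ideal_prod_def
    proof (rule ideal_gen_minimal)
      show "is_ideal (monomial_ideal (edge_power_monomial (Suc s)) :: ('v, 'k) mpoly set)"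
        by (rule is_ideal_monomial_ideal) (rule edge_power_monomial_mult)
      show "{a * b |a b. a \<in> ?I \<and> b \<in> ideal_power ?I s}
          \<subseteq> monomial_ideal (edge_power_monomial (Suc s))"
      proof clarify
        fix a b assume "a \<in> ?I" "b \<in> ideal_power ?I s"
        then have ab: "a \<in> monomial_ideal (edge_power_monomial 1)"
          "b \<in> monomial_ideal (edge_power_monomial s)"
          using edge_ideal_subset Suc by auto
        have "edge_power_monomial (Suc s) m" if "m \<in> Poly_Mapping.keys (a * b)" for m
        proof -
          obtain x y where "m = x + y" "x \<in> Poly_Mapping.keys a" "y \<in> Poly_Mapping.keys b"
            using keys_mult[of a b] \<open>m \<in> _\<close> by blast
          then show ?thesis
            using ab edge_power_monomial_add[of 1 x s y] by (simp add: monomial_ideal_def)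
        qed
        then show "a * b \<in> monomial_ideal (edge_power_monomial (Suc s))"
          by (simp add: monomial_ideal_def)
      qed
    qed
    show "monomial_ideal (edge_power_monomial (Suc s)) \<subseteq> ideal_power ?I (Suc s)"
    proof (rule monomial_ideal_subset)
      show "is_ideal (ideal_power ?I (Suc s))"
        by (rule is_ideal_ideal_power)
      fix m :: "'v \<Rightarrow>\<^sub>0 nat" and c :: 'k
      assume "edge_power_monomial (Suc s) m"
      then obtain i j m' where m: "i \<noteq> j" "edge_power_monomial s m'"
        "m = Poly_Mapping.single i 1 + Poly_Mapping.single j 1 + m'"
        by (rule edge_power_monomial_Suc)
      have "(var i * var j :: ('v, 'k) mpoly) \<in> ?I"
        unfolding edge_ideal_def using m(1) 
        by (intro ideal_gen_base) (auto simp: pair_mem_complete_graph)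
      moreover have "Poly_Mapping.single m' c \<in> ideal_power ?I s"
        using m(2) by (simp add: Suc monomial_ideal_def)
      moreover have "Poly_Mapping.single m c = var i * var j * Poly_Mapping.single m' c"
        by (simp add: m(3) var_def mult_single)
      ultimately show "Poly_Mapping.single m c \<in> ideal_power ?I (Suc s)"
        unfolding ideal_power.simps ideal_prod_def by (intro ideal_gen_base) blast
    qed
  qed
qed

text \<open>For \<open>s = 1\<close> the bound on the total degree follows from the other
  conditions, so the edge ideal is cut out by the covers alone.\<close>

lemma edge_ideal_eq:
  "(edge_ideal complete_graph :: ('v::finite, 'k::comm_ring_1) mpoly set)
    = monomial_ideal (\<lambda>m. \<forall>i. 1 \<le> degree_outside i m)" (is "?I = ?J")
proof
  show "?I \<subseteq> ?J"
    using edge_ideal_subset by (force simp: monomial_ideal_def edge_power_monomial_def)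
  have "monomial_ideal (edge_power_monomial 1) \<subseteq> ?I"
  proof (rule monomial_ideal_subset)
    show I: "is_ideal ?I"
      unfolding edge_ideal_def by (rule is_ideal_ideal_gen)
    fix m :: "'v \<Rightarrow>\<^sub>0 nat" and c :: 'k
    assume "edge_power_monomial 1 m"
    then obtain i j m' where m: "i \<noteq> j"
      "m = Poly_Mapping.single i 1 + Poly_Mapping.single j 1 + m'"
      using edge_power_monomial_Suc[of 0 m] by (metis One_nat_def)
    have "(var i * var j :: ('v, 'k) mpoly) \<in> ?I"
      unfolding edge_ideal_def using m(1)
      by (intro ideal_gen_base) (auto simp: pair_mem_complete_graph)
    moreover have "Poly_Mapping.single m c = Poly_Mapping.single m' c * (var i * var j)"
      by (simp add: m(2) var_def mult_single add.commute)
    ultimately show "Poly_Mapping.single m c \<in> ?I"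
      using I by (simp add: is_ideal_iff)
  qed
  moreover have "edge_power_monomial 1 m" if m: "\<forall>i. 1 \<le> degree_outside i m" for m :: "'v \<Rightarrow>\<^sub>0 nat"
  proof -
    \<comment> \<open>Some variable \<open>i\<close> occurs, and a further factor comes from
      \<open>degree_outside i m\<close>; together they give degree 2.\<close>
    obtain i where "Poly_Mapping.lookup m i > 0"
      using m by (metis One_nat_def degree_outside_zero gr0I lookup_zero not_one_le_zero poly_mapping_eqI)
    then have "2 \<le> monom_degree m"
      using monom_degree_eq[of m i] m[rule_format, of i] by linarith
    then show ?thesis
      using m by (simp add: edge_power_monomial_def)
  qed
  ultimately show "?J \<subseteq> ?I"
    by (force simp: monomial_ideal_def)
qed

section \<open>Symbolic powers\<close>

text \<open>
  The ideal generated by the variables of the minimal vertex cover \<open>UNIV - {i}\<close> is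
  \<open>cover_power i 1\<close>.
\<close>

definition cover_power :: "'v::finite \<Rightarrow> nat \<Rightarrow> ('v, 'k::comm_ring_1) mpoly set" where
  "cover_power i s = monomial_ideal (\<lambda>m. s \<le> degree_outside i m)"

lemma mem_cover_power: "f \<in> cover_power i s \<longleftrightarrow> (\<forall>m\<in>Poly_Mapping.keys f. s \<le> degree_outside i m)"
  by (simp add: cover_power_def monomial_ideal_def)

lemma is_ideal_cover_power: "is_ideal (cover_power i s)"
  unfolding cover_power_def by (rule is_ideal_monomial_ideal) (simp add: degree_outside_add)

text \<open>Powers of these primes are primary: if \<open>f\<close> had a monomial of weight below
  \<open>s\<close> and \<open>g\<close> one of weight 0, their product would have one of weight
  below \<open>s\<close>.\<close>

lemma cover_power_primary:
  fixes f g :: "('v::{finite,linorder}, 'k::idom) mpoly"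
  assumes "f * g \<in> cover_power i s" "g \<notin> cover_power i 1"
  shows "f \<in> cover_power i s"
  using assms min_weight_mult[of "degree_outside i" f s g 0, OF degree_outside_add]
  by (fastforce simp: mem_cover_power not_le)

text \<open>Primality is the case \<open>s = 1\<close> of
  \<open>cover_power_primary\<close>.\<close>

lemma prime_ideal_cover_power:
  "prime_ideal (cover_power i 1 :: ('v::{finite,linorder}, 'k::idom) mpoly set)"
proof -
  have "1 \<notin> (cover_power i 1 :: ('v, 'k) mpoly set)"
    by (simp add: mem_cover_power)
  then show ?thesis
    using cover_power_primary is_ideal_cover_power unfolding prime_ideal_def by blast
qed

text \<open>The decomposition over minimal vertex covers, which for a complete graph are the
  complements of single vertices.\<close>

lemma edge_ideal_eq_INT:
  "(edge_ideal complete_graph :: ('v::finite, 'k::comm_ring_1) mpoly set) = (\<Inter>i. cover_power i 1)"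
  by (auto simp: edge_ideal_eq monomial_ideal_def mem_cover_power)

lemma var_mem_cover_power: "(var v :: ('v::finite, 'k::comm_ring_1) mpoly) \<in> cover_power i 1 \<longleftrightarrow> v \<noteq> i"
  by (simp add: mem_cover_power var_def degree_outside_single)

section \<open>Associated primes and localization\<close>

text \<open>The class of \<open>var i\<close> has annihilator \<open>cover_power i 1\<close>,
  because \<open>var i\<close> lies in all the other primes of the decomposition. Conversely, the
  annihilator of any \<open>f\<close> is the intersection of the primes that miss \<open>f\<close>,
  and it can be prime only if there is exactly one of them.\<close>

lemma Ass_edge_ideal:
  "Ass (edge_ideal complete_graph :: ('v::{finite,linorder}, 'k::idom) mpoly set)
    = range (\<lambda>i. cover_power i 1)" (is "Ass ?I = _")
proof
  show "range (\<lambda>i. cover_power i 1) \<subseteq> Ass ?I"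
  proof clarify
    fix i :: 'v
    have "r * var i \<in> ?I \<longleftrightarrow> r \<in> cover_power i 1" for r :: "('v, 'k) mpoly"
    proof -
      have "r * var i \<in> cover_power j 1 \<longleftrightarrow> j \<noteq> i \<or> r \<in> cover_power i 1" for j
        using is_ideal_mult[OF is_ideal_cover_power, of "var i" j 1 r]
          is_ideal_mult[OF is_ideal_cover_power, of r j 1 "var i"]
          cover_power_primary[of r "var i" j 1]
        by (auto simp: var_mem_cover_power mult.commute simp del: One_nat_def)
      then show ?thesis
        by (auto simp: edge_ideal_eq_INT)
    qed
    then show "cover_power i 1 \<in> Ass ?I"
      unfolding Ass_def using prime_ideal_cover_power[of i] by blast
  qed
  show "Ass ?I \<subseteq> range (\<lambda>i. cover_power i 1)"
  proof
    fix p assume "p \<in> Ass ?I"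
    then obtain f where prime: "prime_ideal p" and p: "p = {r. r * f \<in> ?I}"
      by (auto simp: Ass_def)
    define S where "S = {i. f \<notin> cover_power i 1}"
    have "r * f \<in> cover_power i 1 \<longleftrightarrow> (i \<in> S \<longrightarrow> r \<in> cover_power i 1)" for r i
      using is_ideal_mult[OF is_ideal_cover_power, of f i 1 r]
        is_ideal_mult[OF is_ideal_cover_power, of r i 1 f] cover_power_primary[of r f i 1]
      by (auto simp: S_def mult.commute simp del: One_nat_def)
    then have p_eq: "r \<in> p \<longleftrightarrow> (\<forall>i\<in>S. r \<in> cover_power i 1)" for r
      by (auto simp: p edge_ideal_eq_INT simp del: One_nat_def)
    \<comment> \<open>An empty intersection would make \<open>p\<close> the whole ring.\<close>
    have "S \<noteq> {}"
      using prime p_eq by (auto simp: prime_ideal_def)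
    then obtain i where i: "i \<in> S"
      by blast
    have "j = i" if j: "j \<in> S" for j
    proof (rule ccontr)
      assume "j \<noteq> i"
      \<comment> \<open>Two different indices in \<open>S\<close> give an edge whose product lies in
        \<open>p\<close> although neither factor does.\<close>
      then have "var i * var j \<in> ?I"
        unfolding edge_ideal_def by (intro ideal_gen_base) (auto simp: pair_mem_complete_graph)
      then have "var i * var j \<in> p"
        using p_eq by (simp add: edge_ideal_eq_INT)
      then have "var i \<in> p \<or> var j \<in> p"
        using prime by (simp add: prime_ideal_def)
      then have "(var i :: ('v, 'k) mpoly) \<in> cover_power i 1
          \<or> (var j :: ('v, 'k) mpoly) \<in> cover_power j 1"
        using i j by (simp only: p_eq) blast
      then show False
        by (simp add: mem_cover_power var_def degree_outside_single)
    qed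
    then have "S = {i}"
      using i by blast
    then have "p = cover_power i 1"
      using p_eq by (intro set_eqI) simp
    then show "p \<in> range (\<lambda>i. cover_power i 1)"
      by blast
  qed
qed

text \<open>Localizing the ordinary power at \<open>cover_power i 1\<close> leaves only the
  condition for \<open>i\<close>: primality to \<open>u\<close> removes the denominator, and a power
  of \<open>var i\<close> restores all other conditions.\<close>

lemma symbolic_power_edge_ideal:
  "symbolic_power (edge_ideal complete_graph :: ('v::{finite,linorder}, 'k::idom) mpoly set) s
    = monomial_ideal (\<lambda>m. \<forall>i. s \<le> degree_outside i m)"
proof -
  let ?I = "edge_ideal complete_graph :: ('v, 'k) mpoly set"
  have "Fract f 1 \<in> extension (cover_power i 1) (ideal_power ?I s) \<longleftrightarrow> f \<in> cover_power i s"
    for f and i :: 'v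
    unfolding Fract_mem_extension_iff[OF prime_ideal_cover_power is_ideal_ideal_power]
  proof
    assume "\<exists>u. u \<notin> cover_power i 1 \<and> u * f \<in> ideal_power ?I s"
    then obtain u where u: "u \<notin> cover_power i 1" "f * u \<in> ideal_power ?I s"
      by (auto simp: mult.commute)
    then have "f * u \<in> cover_power i s"
      by (auto simp: ideal_power_edge_ideal monomial_ideal_def edge_power_monomial_def mem_cover_power)
    then show "f \<in> cover_power i s"
      using u(1) by (rule cover_power_primary)
  next
    assume f: "f \<in> cover_power i s"
    \<comment> \<open>The denominator is the \<open>s\<close>-th power of \<open>var i\<close>. It
      raises the degree and every \<open>degree_outside j\<close> with \<open>j \<noteq> i\<close>
      by \<open>s\<close>, and leaves \<open>degree_outside i\<close> unchanged.\<close>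
    let ?u = "Poly_Mapping.single (Poly_Mapping.single i s) 1 :: ('v, 'k) mpoly"
    have "edge_power_monomial s m" if m: "m \<in> Poly_Mapping.keys (?u * f)" for m
    proof -
      obtain y where y: "m = Poly_Mapping.single i s + y" "y \<in> Poly_Mapping.keys f"
        using m keys_mult[of ?u f] by auto
      then have "s \<le> degree_outside i y"
        using f by (simp add: mem_cover_power)
      then show ?thesis
        using monom_degree_eq[of y i]
        by (simp add: edge_power_monomial_def y(1) monom_degree_add degree_outside_add
            monom_degree_single degree_outside_single)
    qed
    then have "?u * f \<in> ideal_power ?I s"
      by (simp add: ideal_power_edge_ideal monomial_ideal_def)
    moreover have "?u \<notin> cover_power i 1"
      by (simp add: mem_cover_power degree_outside_single)
    ultimately show "\<exists>u. u \<notin> cover_power i 1 \<and> u * f \<in> ideal_power ?I s"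
      by blast
  qed
  then show ?thesis
    unfolding symbolic_power_def Ass_edge_ideal by (auto simp: mem_cover_power monomial_ideal_def)
qed

section \<open>Initial degrees\<close>

lemma exists_distinct_pair:
  assumes "CARD('v::finite) \<ge> 2"
  shows "\<exists>u v :: 'v. u \<noteq> v"
  using obtain_subset_with_card_n[OF assms] by (metis card_2_iff)

text \<open>The bound \<open>2 * t\<close> is attained by the \<open>t\<close>-th power of a single
  edge.\<close>

lemma initial_degree_ideal_power:
  assumes "CARD('v::finite) \<ge> 2"
  shows "initial_degree (ideal_power
    (edge_ideal complete_graph :: ('v, 'k::comm_ring_1) mpoly set) t) = 2 * t"
proof -
  obtain u v :: 'v where "u \<noteq> v"
    using exists_distinct_pair[OF assms] by blast
  then have "edge_power_monomial t (Poly_Mapping.single u t + Poly_Mapping.single v t)"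
    by (rule edge_power_monomial_edge)
  then show ?thesis
    unfolding ideal_power_edge_ideal
    by (rule initial_degree_monomial_ideal)
      (auto simp: monom_degree_add monom_degree_single edge_power_monomial_def)
qed

text \<open>Greedy filling: the new element takes \<open>min c N\<close>, and the rest fits into the
  others. It supplies monomials of given degree with bounded exponents.\<close>

lemma exists_bounded_sum_eq:
  fixes c :: nat
  assumes "finite A" "N \<le> card A * c"
  shows "\<exists>g. (\<forall>v. g v \<le> c) \<and> sum g A = N"
  using assms
proof (induction A arbitrary: N rule: finite_induct)
  case empty
  then show ?case
    by (auto intro: exI[of _ "\<lambda>_. 0"])
next
  case (insert x A)
  then have "N - min c N \<le> card A * c"
    by (auto simp: min_def)
  then obtain g where g: "\<forall>v. g v \<le> c" "sum g A = N - min c N"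
    using insert.IH by blast
  have "sum (g(x := min c N)) A = sum g A"
    using insert.hyps by (intro sum.cong) auto
  then have "sum (g(x := min c N)) (insert x A) = N"
    using insert.hyps g(2) by simp
  with g(1) show ?case
    by (intro exI[of _ "g(x := min c N)"]) simp
qed

text \<open>Double counting: the exponent of each variable is missing from exactly one of the
  summands. Written additively to avoid subtraction on naturals.\<close>

lemma sum_degree_outside:
  fixes m :: "'v::finite \<Rightarrow>\<^sub>0 nat"
  shows "(\<Sum>i\<in>UNIV. degree_outside i m) + monom_degree m = CARD('v) * monom_degree m"
proof -
  have "(\<Sum>i\<in>UNIV. degree_outside i m) + monom_degree m
      = (\<Sum>i\<in>UNIV. degree_outside i m + Poly_Mapping.lookup m i)"
    by (simp add: monom_degree_eq_sum sum.distrib)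
  also have "\<dots> = CARD('v) * monom_degree m"
    by (simp flip: monom_degree_eq)
  finally show ?thesis .
qed

text \<open>Let \<open>c\<close> be the ceiling. A monomial of degree \<open>s + c\<close> with all
  exponents at most \<open>c\<close> satisfies every condition, and it exists because
  \<open>s + c \<le> n * c\<close>. Summing the conditions over all variables gives the matching
  lower bound.\<close>

lemma initial_degree_symbolic_power:
  fixes s n :: nat
  assumes n: "n \<ge> 2" "CARD('v::{finite,linorder}) = n"
  shows "int (initial_degree (symbolic_power
      (edge_ideal complete_graph :: ('v, 'k::idom) mpoly set) s))
    = int s + \<lceil>real s / (real n - 1)\<rceil>"
proof -
  define c where "c = nat \<lceil>real s / (real n - 1)\<rceil>"
  have "0 \<le> real s / (real n - 1)"
    using n by simp
  then have c: "int c = \<lceil>real s / (real n - 1)\<rceil>"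
    unfolding c_def by linarith
  have "real s / (real n - 1) \<le> real c"
    using c by linarith
  then have "real s \<le> real c * (real n - 1)"
    using n by (simp add: field_simps)
  then have "real (s + c) \<le> real (n * c)"
    by (simp add: algebra_simps)
  then have "s + c \<le> CARD('v) * c"
    unfolding n(2) of_nat_le_iff .
  then obtain g :: "'v \<Rightarrow> nat" where g: "\<forall>v. g v \<le> c" "sum g UNIV = s + c"
    using exists_bounded_sum_eq[of "UNIV :: 'v set" "s + c" c] by auto
  define m where "m = Poly_Mapping.Abs_poly_mapping g"
  have lookup: "Poly_Mapping.lookup m = g"
    by (simp add: m_def)
  have deg: "monom_degree m = s + c"
    by (simp add: monom_degree_eq_sum lookup g)
  have "s \<le> degree_outside i m" for i
    using monom_degree_eq[of m i] g(1)[rule_format, of i] by (simp add: deg lookup)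
  moreover have "s + c \<le> monom_degree x" if x: "\<forall>i. s \<le> degree_outside i x" for x :: "'v \<Rightarrow>\<^sub>0 nat"
  proof -
    have "n * s \<le> (\<Sum>i\<in>UNIV. degree_outside i x)"
      using sum_mono[of UNIV "\<lambda>_. s" "\<lambda>i. degree_outside i x"] x n by simp
    then have "n * s + monom_degree x \<le> n * monom_degree x"
      using sum_degree_outside[of x] n by simp
    then have "real (n * s + monom_degree x) \<le> real (n * monom_degree x)"
      by linarith
    \<comment> \<open>The summed inequality \<open>n * s \<le> (n - 1) * deg\<close> is rearranged
      so that its left side is the argument of the ceiling.\<close>
    then have "real s / (real n - 1) \<le> real_of_int (int (monom_degree x) - int s)"
      using n by (simp add: field_simps)
    then have "int c \<le> int (monom_degree x) - int s"
      unfolding c by (simp only: ceiling_le_iff)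
    then show ?thesis
      by linarith
  qed
  ultimately have eq: "initial_degree (symbolic_power
      (edge_ideal complete_graph :: ('v, 'k) mpoly set) s) = s + c"
    unfolding symbolic_power_edge_ideal
    by (intro initial_degree_monomial_ideal[of _ m] deg) auto
  show ?thesis
    unfolding eq c[symmetric] by (rule of_nat_add)
qed

section \<open>Containment of symbolic in ordinary powers\<close>

text \<open>The nonzero element \<open>f\<close> ensures that the \<open>LEAST\<close> defining the
  initial degree of \<open>J\<close> is attained.\<close>

lemma initial_degree_antimono:
  assumes "J \<subseteq> K" "f \<in> J" "f \<noteq> 0"
  shows "initial_degree K \<le> initial_degree J"
proof -
  have "\<exists>d. \<exists>f\<in>J. f \<noteq> 0 \<and> total_degree f = d"
    using assms(2,3) by blast
  from LeastI_ex[OF this] have "\<exists>f\<in>J. f \<noteq> 0 \<and> total_degree f = initial_degree J"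
    unfolding initial_degree_def .
  then have "\<exists>f\<in>K. f \<noteq> 0 \<and> total_degree f = initial_degree J"
    using assms(1) by blast
  then show ?thesis
    unfolding initial_degree_def[of K] by (rule Least_le)
qed

lemma initial_degree_le_monom_degree:
  assumes "Poly_Mapping.single m 1 \<in> J"
  shows "initial_degree (J :: ('v, 'k::comm_ring_1) mpoly set) \<le> monom_degree m"
  unfolding initial_degree_def using assms
  by (intro Least_le bexI[of _ "Poly_Mapping.single m 1"])
    (auto simp: total_degree_def simp flip: keys_eq_empty)

text \<open>The two monomial conditions differ by the total degree bound, which the initial degree
  controls, and by the change from \<open>s\<close> to \<open>t\<close>, which is harmless once
  \<open>t \<le> s\<close>.\<close>

lemma symbolic_power_subset_iff:
  fixes s t :: nat and I :: "('v::{finite,linorder}, 'k::idom) mpoly set"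
  assumes n: "CARD('v) \<ge> 2" and I: "I = edge_ideal complete_graph"
  shows "symbolic_power I s \<subseteq> ideal_power I t
    \<longleftrightarrow> initial_degree (ideal_power I t) \<le> initial_degree (symbolic_power I s)"
proof
  obtain u v :: 'v where "u \<noteq> v"
    using exists_distinct_pair[OF n] by blast
  then have "edge_power_monomial s (Poly_Mapping.single u s + Poly_Mapping.single v s)"
    by (rule edge_power_monomial_edge)
  then have "Poly_Mapping.single (Poly_Mapping.single u s + Poly_Mapping.single v s) 1
      \<in> symbolic_power I s"
    by (simp add: I symbolic_power_edge_ideal monomial_ideal_def edge_power_monomial_def)
  then show "symbolic_power I s \<subseteq> ideal_power I t
      \<Longrightarrow> initial_degree (ideal_power I t) \<le> initial_degree (symbolic_power I s)"
    by (rule initial_degree_antimono[rotated]) (simp_all flip: keys_eq_empty)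
next
  assume le: "initial_degree (ideal_power I t) \<le> initial_degree (symbolic_power I s)"
  then have t: "2 * t \<le> initial_degree (symbolic_power I s)"
    unfolding I initial_degree_ideal_power[OF n] .
  \<comment> \<open>As the denominator is at least 1, the initial degree of the symbolic power is at
    most \<open>2 * s\<close>; hence \<open>2 * t \<le> 2 * s\<close>.\<close>
  have "real s / (real CARD('v) - 1) \<le> real s"
    using n mult_left_mono[of 1 "real CARD('v) - 1" "real s"] by (simp add: divide_le_eq)
  then have "\<lceil>real s / (real CARD('v) - 1)\<rceil> \<le> int s"
    by (simp add: ceiling_le_iff)
  then have "t \<le> s"
    using t initial_degree_symbolic_power[OF n refl, where 'k = 'k, of s] unfolding I by linarith
  have "edge_power_monomial t m" if m: "\<forall>i. s \<le> degree_outside i m" for m :: "'v \<Rightarrow>\<^sub>0 nat"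
  proof -
    have "Poly_Mapping.single m 1 \<in> symbolic_power I s"
      using m by (simp add: I symbolic_power_edge_ideal monomial_ideal_def)
    then have "2 * t \<le> monom_degree m"
      using t initial_degree_le_monom_degree[of m "symbolic_power I s"] by linarith
    then show ?thesis
      using m \<open>t \<le> s\<close> by (auto simp: edge_power_monomial_def intro: le_trans)
  qed
  then show "symbolic_power I s \<subseteq> ideal_power I t"
    by (auto simp: I symbolic_power_edge_ideal ideal_power_edge_ideal monomial_ideal_def)
qed

section \<open>Resurgence\<close>

text \<open>Non-containment is a numerical inequality. Dropping the ceiling in it bounds
  \<open>s / t\<close> from above, and a family of pairs indexed by \<open>k\<close> approaches the
  bound.\<close>

lemma resurgence_edge_ideal:
  fixes I :: "('v::{finite,linorder}, 'k::idom) mpoly set"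
  assumes n: "n \<ge> 2" "CARD('v) = n" and I: "I = edge_ideal complete_graph"
  shows "resurgence I = ereal ((2 * real n - 2) / real n)"
proof -
  let ?q = "(2 * real n - 2) / real n"
  let ?A = "{ereal (real s / real t) | s t.
     s \<ge> 1 \<and> t \<ge> 1 \<and> \<not> symbolic_power I s \<subseteq> ideal_power I t}"
  have iff: "\<not> symbolic_power I s \<subseteq> ideal_power I t
      \<longleftrightarrow> int s + \<lceil>real s / (real n - 1)\<rceil> < 2 * int t" for s t
    using symbolic_power_subset_iff[OF _ I, of s t] n
      initial_degree_symbolic_power[OF n, where 'k = 'k, of s]
      initial_degree_ideal_power[where 'v = 'v and 'k = 'k, of t]
    unfolding I by linarith
  have upper: "x \<le> ereal ?q" if "x \<in> ?A" for x
  proof -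
    obtain s t where x: "x = ereal (real s / real t)" and t: "t \<ge> 1"
      and "\<not> symbolic_power I s \<subseteq> ideal_power I t"
      using \<open>x \<in> ?A\<close> unfolding mem_Collect_eq by (elim exE conjE)
    then have st: "int s + \<lceil>real s / (real n - 1)\<rceil> < 2 * int t"
      by (simp only: iff)
    have "real s + real s / (real n - 1) \<le> 2 * real t"
      using st by linarith
    then have "real s * real n \<le> 2 * real t * (real n - 1)"
      using n by (simp add: field_simps)
    then show ?thesis
      using n t by (simp add: x field_simps)
  qed
  have lower: "ereal (?q * (1 - 1 / real (k + 1))) \<le> Sup ?A" if "k \<ge> 1" for k
  proof -
    text \<open>For this \<open>s\<close> the ceiling is exact and the initial degree \<open>2 * k * n\<close> is even.\<close>
    define s where "s = 2 * k * (n - 1)"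
    have s: "real s = 2 * real k * (real n - 1)"
      using n by (simp add: s_def of_nat_diff)
    have "real s / (real n - 1) = of_int (2 * int k)"
      using n by (simp add: s)
    then have "\<lceil>real s / (real n - 1)\<rceil> = 2 * int k"
      by (simp only: ceiling_of_int)
    moreover have "s + 2 * k = 2 * (k * n)"
      using n(1) by (cases n) (simp_all add: s_def)
    then have "int s + 2 * int k = 2 * int (k * n)"
      by (metis of_nat_add of_nat_mult of_nat_numeral)
    \<comment> \<open>The exponent \<open>k * n + 1\<close> is the least \<open>t\<close> with
      \<open>2 * k * n < 2 * t\<close>.\<close>
    ultimately have "\<not> symbolic_power I s \<subseteq> ideal_power I (k * n + 1)"
      unfolding iff by simp
    moreover have "s \<ge> 1"
      using that n by (simp add: s_def)
    ultimately have "ereal (real s / real (k * n + 1)) \<le> Sup ?A"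
      by (intro Sup_upper) (use le_add2 in blast)
    \<comment> \<open>The left side equals \<open>s / ((k + 1) * n)\<close>, and
      \<open>k * n + 1 \<le> (k + 1) * n\<close>.\<close>
    moreover have "?q * (1 - 1 / real (k + 1)) \<le> real s / real (k * n + 1)"
    proof -
      have "1 - 1 / real (k + 1) = real k / real (k + 1)"
        by (simp add: field_simps)
      then have "?q * (1 - 1 / real (k + 1)) = real s / real ((k + 1) * n)"
        by (simp only: s times_divide_times_eq of_nat_mult) (simp add: algebra_simps)
      also have "\<dots> \<le> real s / real (k * n + 1)"
        using n by (intro divide_left_mono) (simp_all flip: of_nat_mult of_nat_add)
      finally show ?thesis .
    qed
    ultimately show ?thesis
      by (meson ereal_less_eq(3) order_trans)
  qed
  have "(\<lambda>k. ?q * (1 - 1 / real (k + 1))) \<longlonglongrightarrow> ?q * (1 - 0)"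
    by (intro tendsto_intros LIMSEQ_ignore_initial_segment[of "\<lambda>k. 1 / real k"] lim_1_over_n)
  then have "(\<lambda>k. ereal (?q * (1 - 1 / real (k + 1)))) \<longlonglongrightarrow> ereal ?q"
    by simp
  then have "ereal ?q \<le> Sup ?A"
    by (rule LIMSEQ_le_const2) (use lower in blast)
  moreover have "Sup ?A \<le> ereal ?q"
    by (rule Sup_least) (rule upper)
  ultimately show ?thesis
    unfolding resurgence_def by (rule antisym[rotated])
qed

section \<open>Waldschmidt constant\<close>

text \<open>The ceiling exceeds its argument by less than 1, so for \<open>s > 0\<close> the
  sequence lies between the limit and the limit plus \<open>1 / s\<close>.\<close>

lemma waldschmidt_seq_edge_ideal_tendsto:
  fixes I :: "('v::{finite,linorder}, 'k::idom) mpoly set"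
  assumes n: "n \<ge> 2" "CARD('v) = n" and I: "I = edge_ideal complete_graph"
  shows "waldschmidt_seq I \<longlonglongrightarrow> real n / (real n - 1)"
proof (rule tendsto_sandwich)
  let ?q = "real n / (real n - 1)"
  have deg: "real (initial_degree (symbolic_power I s)) = real s + \<lceil>real s / (real n - 1)\<rceil>" for s
    using initial_degree_symbolic_power[OF n, where 'k = 'k, of s] unfolding I by linarith
  have mult: "real s * ?q = real s + real s / (real n - 1)" for s
    using n by (simp add: field_simps)
  show "\<forall>\<^sub>F s in sequentially. ?q \<le> waldschmidt_seq I s"
    using eventually_gt_at_top[of 0]
  proof eventually_elim
    case (elim s)
    have "real s * ?q \<le> real (initial_degree (symbolic_power I s))"
      unfolding deg mult by linarith
    then show ?case
      unfolding waldschmidt_seq_def using elim by (simp add: pos_le_divide_eq mult.commute)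
  qed
  show "\<forall>\<^sub>F s in sequentially. waldschmidt_seq I s \<le> ?q + 1 / real s"
    using eventually_gt_at_top[of 0]
  proof eventually_elim
    case (elim s)
    have "real (initial_degree (symbolic_power I s)) \<le> real s * ?q + 1"
      unfolding deg mult by linarith
    also have "\<dots> = (?q + 1 / real s) * real s"
      using elim by (simp add: algebra_simps)
    finally show ?case
      unfolding waldschmidt_seq_def using elim by (simp add: pos_divide_le_eq)
  qed
  show "(\<lambda>s. ?q + 1 / real s) \<longlonglongrightarrow> ?q"
    using tendsto_add[OF tendsto_const lim_1_over_n, of ?q] by simp
qed simp

theorem theorem4p3:
  fixes n :: nat
    and I :: "('v::{finite,linorder}, 'k::field) mpoly set"
  assumes "n \<ge> 2"
    and "CARD('v) = n"
    and "I = edge_ideal complete_graph"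
  shows "((\<forall>s. int (initial_degree (symbolic_power I s)) = int s + \<lceil>real s / (real n - 1)\<rceil>)
           \<and> convergent (waldschmidt_seq I)
           \<and> waldschmidt_constant I = real n / (real n - 1))
       \<and> (\<forall>s t. s \<ge> 1 \<longrightarrow> t \<ge> 1 \<longrightarrow>
             (initial_degree (symbolic_power I s) < initial_degree (ideal_power I t)
                \<longleftrightarrow> \<not> symbolic_power I s \<subseteq> ideal_power I t))
       \<and> resurgence I = ereal ((2 * real n - 2) / real n)"
proof (intro conjI allI impI)
  show "int (initial_degree (symbolic_power I s)) = int s + \<lceil>real s / (real n - 1)\<rceil>" for s
    unfolding assms(3) by (rule initial_degree_symbolic_power[OF assms(1,2)])
  note lim = waldschmidt_seq_edge_ideal_tendsto[OF assms]
  show "convergent (waldschmidt_seq I)"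
    using lim by (rule convergentI)
  show "waldschmidt_constant I = real n / (real n - 1)"
    unfolding waldschmidt_constant_def using lim by (rule limI)
  show "initial_degree (symbolic_power I s) < initial_degree (ideal_power I t)
      \<longleftrightarrow> \<not> symbolic_power I s \<subseteq> ideal_power I t" for s t
    using symbolic_power_subset_iff[OF _ assms(3), of s t] assms(1,2) by auto
  show "resurgence I = ereal ((2 * real n - 2) / real n)"
    by (rule resurgence_edge_ideal[OF assms])
qed

end
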